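(* Let $X$ be a finite set. For any partitions $p$ and $p'$ in $\mathcal{P}(X)$, the geodesic distance satisfies $$d(p,p')=\frac12\big(\mathrm{nc}(p)+\mathrm{nc}(p')\big)-\mathrm{nc}(p\vee p').$$
   Context: $\mathcal{P}(X)$ is the set of partitions of the finite set $X$; $\mathrm{nc}(p)$ is the number of blocks of $p$; $p\vee p'$ is the finest partition which is coarser than both $p$ and $p'$ ($p$ is finer than $p'$, and $p'$ coarser than $p$, if every block of $p$ is contained in a block of $p'$). The Cayley graph $\mathbb{G}$ of $\mathcal{P}(X)$ is the (undirected) graph whose vertex set is $\mathcal{P}(X)$, with an edge between $p$ and $p'$ if and only if one can go from one to the other by gluing (merging) two blocks into one. The geodesic distance is $$d(p,p')=\frac12\min_{\pi}\#\pi,$$ where $\pi$ runs over the paths in $\mathbb{G}$ from $p$ to $p'$ and $\#\pi$ is the length (number of edges) of $\pi$; the constant path from $p$ to $p$ has length $0$. *)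

theory Defs
  imports Complex_Main "HOL-Library.Disjoint_Sets" "Graph_Theory.Graph_Theory"
begin

abbreviation (input) partitions :: "'a set \<Rightarrow> 'a set set set" where
  "partitions X \<equiv> {p. partition_on X p}"

abbreviation (input) nc :: "'a set set \<Rightarrow> nat" where
  "nc p \<equiv> card p"

text \<open>\<open>refines X p q\<close> from the library means that \<open>p\<close> and \<open>q\<close> are partitions of \<open>X\<close>
  and \<open>p\<close> is finer than \<open>q\<close>.\<close>

definition is_partition_join :: "'a set \<Rightarrow> 'a set set \<Rightarrow> 'a set set \<Rightarrow> 'a set set \<Rightarrow> bool" where
  "is_partition_join X p p' q \<longleftrightarrow>
     refines X p q \<and> refines X p' q \<and>
     (\<forall>r. refines X p r \<and> refines X p' r \<longrightarrow> refines X q r)"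

text \<open>The description below is proper by \<open>is_partition_join_partition_join\<close>.\<close>

definition partition_join :: "'a set \<Rightarrow> 'a set set \<Rightarrow> 'a set set \<Rightarrow> 'a set set" where
  "partition_join X p p' = (THE q. is_partition_join X p p' q)"

definition glues_to :: "'a set set \<Rightarrow> 'a set set \<Rightarrow> bool" where
  "glues_to p p' \<longleftrightarrow> (\<exists>a\<in>p. \<exists>b\<in>p. a \<noteq> b \<and> p' = insert (a \<union> b) (p - {a, b}))"

text \<open>As usual in \<open>Graph_Theory\<close>, an undirected graph is a symmetric digraph.\<close>

definition partition_graph :: "'a set \<Rightarrow> 'a set set pair_pre_digraph" where
  "partition_graph X =
     \<lparr>pverts = partitions X,
      parcs = {(p, p') \<in> partitions X \<times> partitions X. glues_to p p' \<or> glues_to p' p}\<rparr>"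

text \<open>A path is given by its list of edges, so its number of edges is the length of the list,
  and the constant path is the empty list. The set of lengths is nonempty by
  \<open>partition_graph_connected\<close> below, hence \<open>LEAST\<close> is a genuine minimum.\<close>

definition partition_dist :: "'a set \<Rightarrow> 'a set set \<Rightarrow> 'a set set \<Rightarrow> real" where
  "partition_dist X p p' =
     (1 / 2) * real (LEAST n. \<exists>\<pi>. pre_digraph.awalk (with_proj (partition_graph X)) p \<pi> p' \<and> n = length \<pi>)"

lemma is_partition_join_partition_join:
  assumes "partition_on X p" "partition_on X p'"
  shows "is_partition_join X p p' (partition_join X p p')"
proof -
  let ?U = "{q. refines X p q \<and> refines X p' q}"
  have ne: "?U \<noteq> {}"
  proof (cases "X = {}")
    case True
    then have "p = {}" "p' = {}"
      using assms by (auto simp: partition_on_empty)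
    with True have "{} \<in> ?U"
      by (auto simp: refines_def partition_on_empty)
    then show ?thesis by blast
  next
    case False
    then have "{X} \<in> ?U"
      using assms by (auto simp: refines_def partition_on_space dest: partition_onD1)
    then show ?thesis by blast
  qed
  have on: "partition_on X q" if "q \<in> ?U" for q
    using that by (auto simp: refines_def)
  have J: "is_partition_join X p p' (common_refinement ?U)"
    unfolding is_partition_join_def
  proof (intro conjI allI impI)
    show "refines X p (common_refinement ?U)"
      by (rule common_refinement_coarsest) (use ne on assms in auto)
    show "refines X p' (common_refinement ?U)"
      by (rule common_refinement_coarsest) (use ne on assms in auto)
    show "refines X (common_refinement ?U) r" if "refines X p r \<and> refines X p' r" for r
      by (rule refines_common_refinement) (use that on in auto)
  qed
  have "q = common_refinement ?U" if "is_partition_join X p p' q" for q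
    using that J unfolding is_partition_join_def by (intro refines_asym[of X]) simp_all
  with J show ?thesis
    unfolding partition_join_def by (rule theI[where P = "is_partition_join X p p'"])
qed

lemma partition_on_glues_to:
  assumes "partition_on X p" "glues_to p p'"
  shows "partition_on X p'"
proof -
  obtain a b where ab: "a \<in> p" "b \<in> p" "a \<noteq> b" "p' = insert (a \<union> b) (p - {a, b})"
    using assms(2) by (auto simp: glues_to_def)
  have disj: "\<And>c d. c \<in> p \<Longrightarrow> d \<in> p \<Longrightarrow> c \<noteq> d \<Longrightarrow> c \<inter> d = {}"
    using partition_onD2[OF assms(1)] by (auto simp: disjoint_def)
  show ?thesis
  proof (rule partition_onI)
    show "\<Union> p' = X"
      using ab partition_onD1[OF assms(1)] by auto
    show "{} \<notin> p'"
      using ab partition_onD3[OF assms(1)] by auto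
    show "disjnt c d" if "c \<in> p'" "d \<in> p'" "c \<noteq> d" for c d
      using that ab disj unfolding disjnt_def by (auto simp: Int_Un_distrib Int_Un_distrib2)
  qed
qed

lemma pair_graph_partition_graph:
  assumes "finite X"
  shows "pair_graph (partition_graph X)"
proof
  have fin: "finite (partitions X)"
    using finitely_many_partition_on[OF assms] .
  then show "finite (pverts (partition_graph X))"
    by (simp add: partition_graph_def)
  show "finite (parcs (partition_graph X))"
    by (rule finite_subset[of _ "partitions X \<times> partitions X"]) (use fin in \<open>auto simp: partition_graph_def\<close>)
  show "fst e \<noteq> snd e" if "e \<in> parcs (partition_graph X)" for e
  proof -
    have "p \<noteq> p'" if p: "partition_on X p" and g: "glues_to p p'" for p p'
    proof
      assume "p = p'"
      with g obtain a b where ab: "a \<in> p" "b \<in> p" "a \<noteq> b" "a \<union> b \<in> p" "a \<notin> p - {a, b}"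
          "p = insert (a \<union> b) (p - {a, b})"
        by (auto simp: glues_to_def)
      then have "a = a \<union> b" "b = a \<union> b" by blast+
      with ab show False by simp
    qed
    then show ?thesis
      using that by (fastforce simp: partition_graph_def)
  qed
  show "symmetric (with_proj (partition_graph X))"
    by (auto simp: partition_graph_def symmetric_def sym_def)
qed (auto simp: partition_graph_def)

lemma partition_graph_connected:
  assumes "finite X" "partition_on X p" "partition_on X p'"
  shows "\<exists>\<pi>. pre_digraph.awalk (with_proj (partition_graph X)) p \<pi> p'"
proof -
  interpret G: pair_graph "partition_graph X"
    by (rule pair_graph_partition_graph) fact
  let ?t = "if X = {} then {} else {X}"
  have top: "p \<rightarrow>\<^sup>*\<^bsub>with_proj (partition_graph X)\<^esub> ?t" if "partition_on X p" for p
    using that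
  proof (induction "card p" arbitrary: p rule: less_induct)
    case less
    show ?case
    proof (cases "\<exists>a\<in>p. \<exists>b\<in>p. a \<noteq> b")
      case True
      then obtain a b where ab: "a \<in> p" "b \<in> p" "a \<noteq> b" by blast
      let ?q = "insert (a \<union> b) (p - {a, b})"
      have g: "glues_to p ?q" using ab by (auto simp: glues_to_def)
      have q: "partition_on X ?q" using partition_on_glues_to[OF less.prems g] .
      have fin: "finite p" using finite_elements[OF assms(1) less.prems] .
      have "card (p - {a, b}) = card p - 2"
        using ab fin by (subst card_Diff_subset) auto
      moreover have "card {a, b} \<le> card p" using ab fin by (intro card_mono) auto
      ultimately have "card ?q < card p"
        using ab fin card_insert_le_m1[of "card p - 1" "p - {a, b}" "a \<union> b"] by auto
      then have "?q \<rightarrow>\<^sup>*\<^bsub>with_proj (partition_graph X)\<^esub> ?t" using less.hyps q by blast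
      moreover have "(p, ?q) \<in> parcs (partition_graph X)"
        using g q less.prems by (auto simp: partition_graph_def)
      ultimately show ?thesis
        by (intro G.adj_reachable_trans[of p ?q]) auto
    next
      case False
      then consider "p = {}" | c where "p = {c}" by blast
      then have "p = ?t"
        using partition_onD1[OF less.prems] partition_onD3[OF less.prems] by cases auto
      moreover have "p \<in> pverts (partition_graph X)"
        using less.prems by (simp add: partition_graph_def)
      ultimately show ?thesis
        using G.reachable_refl by metis
    qed
  qed
  have "p \<rightarrow>\<^sup>*\<^bsub>with_proj (partition_graph X)\<^esub> p'"
    using top[OF assms(2)] top[OF assms(3)] symmetric_reachable[OF G.sym_arcs]
      G.reachable_trans by blast
  then show ?thesis
    using G.reachable_awalk by blast
qed

end

(* A path of gluings realises any coarsening, so travelling from p to p' through the join costs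
   nc p + nc p' - 2 nc (join) edges. Conversely, gluing two blocks of p lowers nc p by one and
   nc (join p p') by at most one, so nc p + nc p' - 2 nc (join p p') changes by at most one
   along an edge, and it vanishes for p = p'. *)
theory Submission
  imports Defs
begin

text \<open>Every block of \<open>q\<close> is a nonempty union of blocks of \<open>p\<close>.
  Choosing one of these for each block of \<open>q\<close> is injective, because distinct blocks of
  \<open>q\<close> are disjoint.\<close>

lemma refines_card_le:
  assumes "finite X" "refines X p q"
  shows "card q \<le> card p"
proof -
  have p: "partition_on X p" and q: "partition_on X q"
    using assms(2) by (auto simp: refines_def)
  have "\<exists>a\<in>p. a \<subseteq> c" if "c \<in> q" for c
  proof -
    have "\<Union>{a \<in> p. a \<subseteq> c} = c"
      using refines_obtains_subset[OF assms(2) that] by (simp add: partition_on_def)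
    moreover have "c \<noteq> {}" using q that by (auto simp: partition_on_def)
    ultimately show ?thesis by blast
  qed
  then obtain g where g: "\<And>c. c \<in> q \<Longrightarrow> g c \<in> p \<and> g c \<subseteq> c" by metis
  have "inj_on g q"
  proof (rule inj_onI, rule ccontr)
    fix c d assume cd: "c \<in> q" "d \<in> q" "g c = g d" "c \<noteq> d"
    then have "c \<inter> d = {}" using q by (auto simp: partition_on_def disjoint_def)
    moreover have "g c \<subseteq> c \<inter> d" "g c \<noteq> {}"
      using g[of c] g[of d] cd p by (auto simp: partition_on_def)
    ultimately show False by blast
  qed
  then show ?thesis
    using g finite_elements[OF assms(1) p] by (intro card_inj_on_le) auto
qed

lemma glues_to_card:
  assumes "finite X" "partition_on X p" "glues_to p q"
  shows "card p = Suc (card q)"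
proof -
  obtain a b where ab: "a \<in> p" "b \<in> p" "a \<noteq> b" "q = insert (a \<union> b) (p - {a, b})"
    using assms(3) by (auto simp: glues_to_def)
  have fin: "finite p" using finite_elements assms by blast
  \<comment> \<open>The merged block must be new, or the count would drop by two: as a block of
    \<open>p\<close> other than \<open>a\<close> it would be disjoint from \<open>a\<close>, forcing
    \<open>a\<close> to be empty.\<close>
  have "a \<union> b \<notin> p - {a, b}"
  proof
    assume "a \<union> b \<in> p - {a, b}"
    then have m: "a \<union> b \<in> p" "a \<union> b \<noteq> a" by auto
    have "(a \<union> b) \<inter> a = {}"
      using disjointD[OF partition_onD2[OF assms(2)] m(1) ab(1) m(2)] .
    then have "a = {}" by blast
    then show False using partition_onD3[OF assms(2)] ab(1) by simp
  qed
  moreover have "card (p - {a, b}) = card p - 2"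
    using ab fin by (subst card_Diff_subset) auto
  moreover have "card {a, b} \<le> card p" using ab fin by (intro card_mono) auto
  ultimately show ?thesis using ab fin by simp
qed

lemma glues_to_refines:
  assumes "partition_on X p" "glues_to p q"
  shows "refines X p q"
  using assms partition_on_glues_to[OF assms] by (fastforce simp: refines_def glues_to_def)

text \<open>Supplies two blocks that can be glued without leaving the partitions finer than
  \<open>r\<close>. If each block of \<open>r\<close> contained only one block of \<open>p\<close>,
  it would equal that block, so \<open>r\<close> would also refine \<open>p\<close>, and
  antisymmetry would give \<open>p = r\<close>.\<close>

lemma refines_neq_obtain:
  assumes "refines X p r" "p \<noteq> r"
  obtains a b c where "a \<in> p" "b \<in> p" "a \<noteq> b" "c \<in> r" "a \<union> b \<subseteq> c"
proof (rule ccontr)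
  assume "\<not> thesis"
  with that have uniq: "a = b" if "a \<in> p" "b \<in> p" "c \<in> r" "a \<subseteq> c" "b \<subseteq> c" for a b c
    using that by (meson Un_least)
  have "c \<in> p" if c: "c \<in> r" for c
  proof -
    have P: "\<Union>{a \<in> p. a \<subseteq> c} = c"
      using refines_obtains_subset[OF assms(1) c] by (simp add: partition_on_def)
    have "c \<noteq> {}" using assms(1) c by (auto simp: refines_def partition_on_def)
    then obtain a where a: "a \<in> p" "a \<subseteq> c" using P by blast
    then have "{a \<in> p. a \<subseteq> c} = {a}" using uniq[OF _ _ c] by blast
    with P a show ?thesis by simp
  qed
  then have "refines X r p" using assms(1) by (auto simp: refines_def)
  with assms show False using refines_asym by blast
qed

lemma pverts_partition_graph [simp]: "p \<in> pverts (partition_graph X) \<longleftrightarrow> partition_on X p"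
  by (simp add: partition_graph_def)

lemma parcs_partition_graph [simp]:
  "(p, q) \<in> parcs (partition_graph X) \<longleftrightarrow>
    partition_on X p \<and> partition_on X q \<and> (glues_to p q \<or> glues_to q p)"
  by (simp add: partition_graph_def)

text \<open>Gluing two blocks that lie in a common block of \<open>r\<close> lowers the count by one
  and keeps the partition finer than \<open>r\<close>; this is repeated until \<open>r\<close> is
  reached. The additive form avoids truncated subtraction.\<close>

lemma awalk_refines:
  assumes "finite X" "refines X p r"
  shows "\<exists>\<pi>. pre_digraph.awalk (with_proj (partition_graph X)) p \<pi> r \<and> length \<pi> + card r = card p"
proof -
  interpret G: pair_graph "partition_graph X"
    by (rule pair_graph_partition_graph) fact
  show ?thesis
    using assms(2)
  proof (induction "card p" arbitrary: p rule: less_induct)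
    case less
    have p: "partition_on X p" and r: "partition_on X r"
      using less.prems by (auto simp: refines_def)
    show ?case
    proof (cases "p = r")
      case True
      have "G.awalk p [] r" using True r by (simp add: G.awalk_Nil_iff)
      with True show ?thesis by (intro exI[of _ "[]"]) simp
    next
      case False
      then obtain a b c where ab: "a \<in> p" "b \<in> p" "a \<noteq> b" "c \<in> r" "a \<union> b \<subseteq> c"
        using refines_neq_obtain[OF less.prems] by metis
      let ?q = "insert (a \<union> b) (p - {a, b})"
      have g: "glues_to p ?q" using ab unfolding glues_to_def by blast
      have q: "partition_on X ?q" using partition_on_glues_to[OF p g] .
      have c: "card p = Suc (card ?q)" using glues_to_card[OF assms(1) p g] .
      have "refines X ?q r"
        using q r ab less.prems by (auto simp: refines_def)
      then obtain \<pi> where \<pi>: "G.awalk ?q \<pi> r" "length \<pi> + card r = card ?q"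
        using less.hyps[of ?q] c by auto
      have "G.awalk p ((p, ?q) # \<pi>) r"
        using \<pi>(1) p q g by (simp add: G.awalk_Cons_iff)
      then show ?thesis using \<pi>(2) c by (intro exI[of _ "(p, ?q) # \<pi>"]) simp
    qed
  qed
qed

text \<open>The new join is also coarser than \<open>p\<close>, hence coarser than the old join.
  Conversely, gluing at most two blocks of the old join yields a partition coarser than both
  \<open>q\<close> and \<open>p'\<close>, hence coarser than the new join.\<close>

lemma card_join_glues_to:
  assumes "finite X" "partition_on X p" "partition_on X p'" "glues_to p q"
  shows "card (partition_join X q p') \<le> card (partition_join X p p')"
    and "card (partition_join X p p') \<le> Suc (card (partition_join X q p'))"
proof -
  let ?J = "partition_join X p p'" and ?K = "partition_join X q p'"
  have q: "partition_on X q" using partition_on_glues_to assms by blast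
  have J: "is_partition_join X p p' ?J" and K: "is_partition_join X q p' ?K"
    using is_partition_join_partition_join assms q by blast+
  have "refines X p ?K"
    using K glues_to_refines[OF assms(2,4)] refines_trans by (metis is_partition_join_def)
  then have "refines X ?J ?K" using J K by (simp add: is_partition_join_def)
  then show "card ?K \<le> card ?J" by (rule refines_card_le[OF assms(1)])
  have Jp: "partition_on X ?J" using J by (simp add: is_partition_join_def refines_def)
  obtain a b where ab: "a \<in> p" "b \<in> p" "a \<noteq> b" "q = insert (a \<union> b) (p - {a, b})"
    using assms(4) by (auto simp: glues_to_def)
  have pJ: "refines X p ?J" and p'J: "refines X p' ?J"
    using J by (auto simp: is_partition_join_def)
  \<comment> \<open>If the blocks of the join around \<open>a\<close> and \<open>b\<close> coincide,
    \<open>q\<close> already refines the join; otherwise these two blocks have to be glued as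
    well.\<close>
  obtain A B where AB: "A \<in> ?J" "a \<subseteq> A" "B \<in> ?J" "b \<subseteq> B"
    using pJ ab unfolding refines_def by meson
  show "card ?J \<le> Suc (card ?K)"
  proof (cases "A = B")
    case True
    have "refines X q ?J"
      using pJ q ab AB True by (auto simp: refines_def)
    then have "refines X ?K ?J" using K p'J by (simp add: is_partition_join_def)
    then show ?thesis using refines_card_le[OF assms(1)] by fastforce
  next
    case False
    let ?R = "insert (A \<union> B) (?J - {A, B})"
    have g: "glues_to ?J ?R" using AB False unfolding glues_to_def by blast
    have JR: "refines X ?J ?R" using glues_to_refines[OF Jp g] .
    have pR: "refines X p ?R" and p'R: "refines X p' ?R"
      using pJ p'J JR refines_trans by blast+
    have "\<exists>Y\<in>?R. Z \<subseteq> Y" if "Z \<in> q" for Z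
    proof (cases "Z = a \<union> b")
      case True
      then show ?thesis using AB by (intro bexI[of _ "A \<union> B"]) auto
    next
      case False
      then have "Z \<in> p" using that ab by auto
      then show ?thesis using pR unfolding refines_def by blast
    qed
    then have "refines X q ?R" using q pR by (simp add: refines_def)
    then have "refines X ?K ?R" using K p'R by (simp add: is_partition_join_def)
    then have "card ?R \<le> card ?K" by (rule refines_card_le[OF assms(1)])
    then show ?thesis using glues_to_card[OF assms(1) Jp g] by simp
  qed
qed

lemma partition_join_idem:
  assumes "partition_on X p"
  shows "partition_join X p p = p"
  using is_partition_join_partition_join[OF assms assms] refines_refl[OF assms] refines_asym
  unfolding is_partition_join_def by metis

text \<open>Induction along the path: the constant path gives equality, since the join of
  \<open>p'\<close> with itself is \<open>p'\<close>, and each edge accounts for a change of at most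
  one.\<close>

lemma length_awalk_ge:
  assumes "finite X" "pre_digraph.awalk (with_proj (partition_graph X)) p \<pi> p'"
    "partition_on X p'"
  shows "card p + card p' \<le> length \<pi> + 2 * card (partition_join X p p')"
proof -
  interpret G: pair_graph "partition_graph X"
    by (rule pair_graph_partition_graph) fact
  show ?thesis
    using assms(2)
  proof (induction \<pi> arbitrary: p)
    case Nil
    then show ?case
      using partition_join_idem[OF assms(3)] by (simp add: G.awalk_Nil_iff)
  next
    case (Cons e \<pi>)
    obtain q where e: "e = (p, q)" using Cons.prems by (cases e) (simp add: G.awalk_Cons_iff)
    have pq: "partition_on X p" "partition_on X q" "glues_to p q \<or> glues_to q p"
      using Cons.prems e by (auto simp: G.awalk_Cons_iff)
    have IH: "card q + card p' \<le> length \<pi> + 2 * card (partition_join X q p')"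
      using Cons e by (simp add: G.awalk_Cons_iff)
    from pq(3) show ?case
    proof
      assume g: "glues_to p q"
      show ?thesis
        using IH card_join_glues_to(1)[OF assms(1) pq(1) assms(3) g]
          glues_to_card[OF assms(1) pq(1) g] by simp
    next
      \<comment> \<open>Here \<open>q\<close> has one block more than \<open>p\<close>, while its
        join with \<open>p'\<close> has at most one block more. Doubling the latter leaves a net
        loss of at most one, which the edge pays for.\<close>
      assume g: "glues_to q p"
      show ?thesis
        using IH card_join_glues_to(2)[OF assms(1) pq(2) assms(3) g]
          glues_to_card[OF assms(1) pq(2) g] by simp
    qed
  qed
qed

theorem theorem2p1:
  fixes X :: "'a set" and p p' :: "'a set set"
  assumes "finite X"
    and "p \<in> partitions X"
    and "p' \<in> partitions X"
  shows "partition_dist X p p' =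
    (1 / 2) * (real (nc p) + real (nc p')) - real (nc (partition_join X p p'))"
proof -
  interpret G: pair_graph "partition_graph X"
    by (rule pair_graph_partition_graph) fact
  let ?J = "partition_join X p p'"
  have p: "partition_on X p" and p': "partition_on X p'" using assms by auto
  have J: "refines X p ?J" "refines X p' ?J"
    using is_partition_join_partition_join[OF p p'] by (auto simp: is_partition_join_def)
  obtain \<pi> where \<pi>: "G.awalk p \<pi> ?J" "length \<pi> + card ?J = card p"
    using awalk_refines[OF assms(1) J(1)] by blast
  obtain \<rho> where \<rho>: "G.awalk p' \<rho> ?J" "length \<rho> + card ?J = card p'"
    using awalk_refines[OF assms(1) J(2)] by blast
  have len: "length (rev_path \<rho>) = length \<rho>" by (induction \<rho>) auto
  \<comment> \<open>The candidate for a shortest path climbs from \<open>p\<close> to the join and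
    then follows \<open>\<rho>\<close> backwards, which is possible since the graph is
    symmetric.\<close>
  have w: "G.awalk p (\<pi> @ rev_path \<rho>) p'"
    using \<pi>(1) \<rho>(1) G.awalk_appendI by (metis G.awalk_rev_path)
  have "(LEAST n. \<exists>\<pi>. G.awalk p \<pi> p' \<and> n = length \<pi>) = length \<pi> + length \<rho>"
  proof (rule Least_equality)
    show "\<exists>\<sigma>. G.awalk p \<sigma> p' \<and> length \<pi> + length \<rho> = length \<sigma>"
      using w len by (intro exI[of _ "\<pi> @ rev_path \<rho>"]) simp
    \<comment> \<open>Adding the two length equations turns the lower bound for paths into exactly
      this inequality.\<close>
    show "length \<pi> + length \<rho> \<le> n" if "\<exists>\<sigma>. G.awalk p \<sigma> p' \<and> n = length \<sigma>" for n
      using that length_awalk_ge[OF assms(1) _ p', of p] \<pi>(2) \<rho>(2) by force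
  qed
  then show ?thesis
    by (simp add: partition_dist_def field_simps flip: \<pi>(2) \<rho>(2))
qed

end
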